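(* The full subcategory $\mathbf{HDTS}$ of higher dimensional transition systems is a small-orthogonality class of the category $\mathbf{WHDTS}$ of weak higher dimensional transition systems. More precisely, it is the full subcategory of objects orthogonal to the (unique) morphisms $D[a]\to C_1[a]$ for $a\in\Sigma$ and to the inclusions $C_n[a_1,\dots,a_n]^{ext}\subset C_n[a_1,\dots,a_n]$ for $n\ge2$ and $a_1,\dots,a_n\in\Sigma$.
   Context: $\Sigma$ is a fixed nonempty set of labels. A weak higher dimensional transition system is a triple $(S,\mu:L\to\Sigma,T=\bigcup_{n\ge1}T_n)$ with $S$ a set (states), $L$ a set (actions), $\mu$ a set map (labelling map) and $T_n\subset S\times L^n\times S$ ($n$-transitions) such that: - (Multiset axiom) for every permutation $\sigma$ of $\{1,\dots,n\}$, $n\ge2$, if $(\alpha,u_1,\dots,u_n,\beta)\in T$ then $(\alpha,u_{\sigma(1)},\dots,u_{\sigma(n)},\beta)\in T$; - (Coherence axiom) for $n\ge3$, $p,q\ge1$ with $p+q<n$, if $(\alpha,u_1,\dots,u_n,\beta)$, $(\alpha,u_1,\dots,u_p,\nu_1)$, $(\nu_1,u_{p+1},\dots,u_n,\beta)$, $(\alpha,u_1,\dots,u_{p+q},\nu_2)$, $(\nu_2,u_{p+q+1},\dots,u_n,\beta)$ are transitions, then $(\nu_1,u_{p+1},\dots,u_{p+q},\nu_2)$ is a transition. A morphism $f$ consists of a map $f_0$ on states and a map $\widetilde f$ on actions commuting with the labelling maps, such that $(f_0(\alpha),\widetilde f(u_1),\dots,\widetilde f(u_n),f_0(\beta))$ is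 a transition whenever $(\alpha,u_1,\dots,u_n,\beta)$ is. The category is $\mathbf{WHDTS}$. A higher dimensional transition system is a triple $(S,\mu:L\to\Sigma,T=\bigcup_{n\ge 1}T_n)$ with $T_n\subset S\times L^n\times S$ satisfying the Multiset axiom and: - (CSA1) if $(\alpha,u,\beta)$ and $(\alpha,u',\beta)$ are transitions and $\mu(u)=\mu(u')$ then $u=u'$; - (CSA2) for every $n\ge2$, $1\le p<n$ and transition $(\alpha,u_1,\dots,u_n,\beta)$, there exist a unique state $\nu_1$ and a unique state $\nu_2$ such that $(\alpha,u_1,\dots,u_p,\nu_1)$, $(\nu_1,u_{p+1},\dots,u_n,\beta)$, $(\alpha,u_{p+1},\dots,u_n,\nu_2)$, $(\nu_2,u_1,\dots,u_p,\beta)$ are transitions; - (CSA3) for all states $\alpha,\beta,\nu_1,\nu_2,\nu_1',\nu_2'$, actions $u_1,\dots,u_n$ and $p,q\ge1$ with $p+q<n$, if $(\alpha,u_1,\dots,u_n,\beta)$, $(\alpha,u_1,\dots,u_p,\nu_1)$, $(\nu_1,u_{p+1},\dots,u_n,\beta)$, $(\nu_1,u_{p+1},\dots,u_{p+q},\nu_2)$, $(\nu_2,u_{p+q+1},\dots,u_n,\beta)$, $(\alpha,u_1,\dots,u_{p+q},\nu_2')$, $(\nu_2',u_{p+q+1},\dots,u_n,\beta)$, $(\alpha,u_1,\dots,u_p,\nu_1')$, $(\nu_1',u_{p+1},\dots,u_{p+q},\nu_2')$ are transitions, then $\nu_1=\nu_1'$ and $\nu_2=\nu_2'$. Every higher dimensional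 transition system is a weak one; $\mathbf{HDTS}$ is the full subcategory of $\mathbf{WHDTS}$ of higher dimensional transition systems. $C_n[a_1,\dots,a_n]$ has set of states $\{0,1\}^n$, set of actions $\{(a_1,1),\dots,(a_n,n)\}$, labelling $\mu(a_i,i)=a_i$, and its $d$-transitions ($d\ge1$) are the tuples $((\epsilon_1,\dots,\epsilon_n),(a_{i_1},i_1),\dots,(a_{i_d},i_d),(\epsilon_1',\dots,\epsilon_n'))$ with $i_1,\dots,i_d$ pairwise distinct, $\epsilon_i\le\epsilon_i'$ for all $i$, and $\epsilon_i\ne\epsilon_i'$ iff $i\in\{i_1,\dots,i_d\}$. With $0_n=(0,\dots,0)$ and $1_n=(1,\dots,1)$, $C_n[a_1,\dots,a_n]^{ext}$ has set of states $\{0_n,1_n\}$, the same actions and labelling, and transitions the tuples $(0_n,(a_{\sigma(1)},\sigma(1)),\dots,(a_{\sigma(n)},\sigma(n)),1_n)$ for $\sigma$ a permutation of $\{1,\dots,n\}$. $D[a]$ has set of states $\{0,1\}$, set of actions $\{(a,1),(a,2)\}$, labelling $\mu(a,i)=a$, and exactly the two transitions $(0,(a,1),1)$ and $(0,(a,2),1)$. An object $C$ is orthogonal to a map $X\to Y$ if every map $X\to C$ factors uniquely through $X\to Y$. A small-orthogonality class is the full subcategory of objects orthogonal to every morphism of a given set of morphisms. *)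

theory Defs
  imports "HOL-Combinatorics.Permutations" "HOL-Library.FuncSet"
begin

text \<open>
  An \<open>n\<close>-transition \<open>(\<alpha>, u\<^sub>1, \<dots>, u\<^sub>n, \<beta>)\<close> is the triple \<open>(\<alpha>, [u\<^sub>1, \<dots>, u\<^sub>n], \<beta>)\<close>,
  so \<open>T\<^sub>n\<close> is the set of transitions whose list has length \<open>n\<close>. The values of \<open>label\<close> outside
  \<open>actions\<close> are irrelevant.
\<close>

record ('s, 'l, 'a) ts =
  states :: "'s set"
  actions :: "'l set"
  label :: "'l \<Rightarrow> 'a"
  transitions :: "('s \<times> 'l list \<times> 's) set"

definition ts_carrier :: "'a set \<Rightarrow> ('s, 'l, 'a) ts \<Rightarrow> bool" where
  "ts_carrier \<Sigma> X \<longleftrightarrow>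
     label X \<in> actions X \<rightarrow> \<Sigma> \<and>
     (\<forall>\<alpha> us \<beta>. (\<alpha>, us, \<beta>) \<in> transitions X \<longrightarrow>
        \<alpha> \<in> states X \<and> 1 \<le> length us \<and> set us \<subseteq> actions X \<and> \<beta> \<in> states X)"

definition multiset_axiom :: "('s, 'l, 'a) ts \<Rightarrow> bool" where
  "multiset_axiom X \<longleftrightarrow>
     (\<forall>\<alpha> us \<beta> \<sigma>. 2 \<le> length us \<and> \<sigma> permutes {..<length us} \<and> (\<alpha>, us, \<beta>) \<in> transitions X \<longrightarrow>
        (\<alpha>, permute_list \<sigma> us, \<beta>) \<in> transitions X)"

definition coherence_axiom :: "('s, 'l, 'a) ts \<Rightarrow> bool" where
  "coherence_axiom X \<longleftrightarrow>
     (\<forall>\<alpha> us \<beta> \<nu>1 \<nu>2 p q.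
        3 \<le> length us \<and> 1 \<le> p \<and> 1 \<le> q \<and> p + q < length us \<and>
        (\<alpha>, us, \<beta>) \<in> transitions X \<and>
        (\<alpha>, take p us, \<nu>1) \<in> transitions X \<and> (\<nu>1, drop p us, \<beta>) \<in> transitions X \<and>
        (\<alpha>, take (p + q) us, \<nu>2) \<in> transitions X \<and> (\<nu>2, drop (p + q) us, \<beta>) \<in> transitions X \<longrightarrow>
        (\<nu>1, take q (drop p us), \<nu>2) \<in> transitions X)"

definition whdts :: "'a set \<Rightarrow> ('s, 'l, 'a) ts \<Rightarrow> bool" where
  "whdts \<Sigma> X \<longleftrightarrow> ts_carrier \<Sigma> X \<and> multiset_axiom X \<and> coherence_axiom X"

definition CSA1 :: "('s, 'l, 'a) ts \<Rightarrow> bool" where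
  "CSA1 X \<longleftrightarrow>
     (\<forall>\<alpha> u u' \<beta>. (\<alpha>, [u], \<beta>) \<in> transitions X \<and> (\<alpha>, [u'], \<beta>) \<in> transitions X \<and> label X u = label X u' \<longrightarrow>
        u = u')"

definition CSA2 :: "('s, 'l, 'a) ts \<Rightarrow> bool" where
  "CSA2 X \<longleftrightarrow>
     (\<forall>\<alpha> us \<beta> p. 2 \<le> length us \<and> 1 \<le> p \<and> p < length us \<and> (\<alpha>, us, \<beta>) \<in> transitions X \<longrightarrow>
        (\<exists>!\<nu>1. \<nu>1 \<in> states X \<and>
           (\<alpha>, take p us, \<nu>1) \<in> transitions X \<and> (\<nu>1, drop p us, \<beta>) \<in> transitions X) \<and>
        (\<exists>!\<nu>2. \<nu>2 \<in> states X \<and>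
           (\<alpha>, drop p us, \<nu>2) \<in> transitions X \<and> (\<nu>2, take p us, \<beta>) \<in> transitions X))"

definition CSA3 :: "('s, 'l, 'a) ts \<Rightarrow> bool" where
  "CSA3 X \<longleftrightarrow>
     (\<forall>\<alpha> us \<beta> \<nu>1 \<nu>2 \<nu>1' \<nu>2' p q.
        1 \<le> p \<and> 1 \<le> q \<and> p + q < length us \<and>
        (\<alpha>, us, \<beta>) \<in> transitions X \<and>
        (\<alpha>, take p us, \<nu>1) \<in> transitions X \<and> (\<nu>1, drop p us, \<beta>) \<in> transitions X \<and>
        (\<nu>1, take q (drop p us), \<nu>2) \<in> transitions X \<and> (\<nu>2, drop (p + q) us, \<beta>) \<in> transitions X \<and>
        (\<alpha>, take (p + q) us, \<nu>2') \<in> transitions X \<and> (\<nu>2', drop (p + q) us, \<beta>) \<in> transitions X \<and>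
        (\<alpha>, take p us, \<nu>1') \<in> transitions X \<and> (\<nu>1', take q (drop p us), \<nu>2') \<in> transitions X \<longrightarrow>
        \<nu>1 = \<nu>1' \<and> \<nu>2 = \<nu>2')"

definition hdts :: "'a set \<Rightarrow> ('s, 'l, 'a) ts \<Rightarrow> bool" where
  "hdts \<Sigma> X \<longleftrightarrow> ts_carrier \<Sigma> X \<and> multiset_axiom X \<and> CSA1 X \<and> CSA2 X \<and> CSA3 X"

text \<open>
  Morphisms are pairs of extensional functions, so that equality of pairs is equality of morphisms.
\<close>

definition hom ::
    "('s, 'l, 'a) ts \<Rightarrow> ('t, 'm, 'a) ts \<Rightarrow> (('s \<Rightarrow> 't) \<times> ('l \<Rightarrow> 'm)) set" where
  "hom X Y = {(f0, f1).
     f0 \<in> states X \<rightarrow>\<^sub>E states Y \<and> f1 \<in> actions X \<rightarrow>\<^sub>E actions Y \<and>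
     (\<forall>u \<in> actions X. label Y (f1 u) = label X u) \<and>
     (\<forall>\<alpha> us \<beta>. (\<alpha>, us, \<beta>) \<in> transitions X \<longrightarrow> (f0 \<alpha>, map f1 us, f0 \<beta>) \<in> transitions Y)}"

definition comp_from ::
    "('s, 'l, 'a) ts \<Rightarrow> ('t \<Rightarrow> 'r) \<times> ('m \<Rightarrow> 'k) \<Rightarrow> ('s \<Rightarrow> 't) \<times> ('l \<Rightarrow> 'm) \<Rightarrow> ('s \<Rightarrow> 'r) \<times> ('l \<Rightarrow> 'k)" where
  "comp_from X g f =
     (compose (states X) (fst g) (fst f), compose (actions X) (snd g) (snd f))"

definition orthogonal ::
    "('r, 'k, 'a) ts \<Rightarrow>
     ('s, 'l, 'a) ts \<times> (('s \<Rightarrow> 't) \<times> ('l \<Rightarrow> 'm)) \<times> ('t, 'm, 'a) ts \<Rightarrow> bool" where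
  "orthogonal C m \<longleftrightarrow>
     (case m of (X, i, Y) \<Rightarrow> \<forall>f \<in> hom X C. \<exists>!g. g \<in> hom Y C \<and> comp_from X g i = f)"

type_synonym ('s, 'l, 'a) ts_mor =
  "('s, 'l, 'a) ts \<times> (('s \<Rightarrow> 's) \<times> ('l \<Rightarrow> 'l)) \<times> ('s, 'l, 'a) ts"

definition whdts_morphisms :: "'a set \<Rightarrow> ('s, 'l, 'a) ts_mor set" where
  "whdts_morphisms \<Sigma> = {(X, f, Y). whdts \<Sigma> X \<and> whdts \<Sigma> Y \<and> f \<in> hom X Y}"

text \<open>
  A full subcategory is represented by its class of objects, since the two determine each other.
\<close>

definition HDTS :: "'a set \<Rightarrow> ('s, 'l, 'a) ts set" where
  "HDTS \<Sigma> = {C. hdts \<Sigma> C}"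

definition orthogonality_class ::
    "'a set \<Rightarrow> ('t, 'm, 'a) ts_mor set \<Rightarrow> ('s, 'l, 'a) ts set" where
  "orthogonality_class \<Sigma> M = {C. whdts \<Sigma> C \<and> (\<forall>m \<in> M. orthogonal C m)}"

text \<open>
  The labels \<open>a\<^sub>1, \<dots>, a\<^sub>n\<close> are given as a list, which Isabelle indexes from \<open>0\<close>: the action
  \<open>(a\<^sub>i, i)\<close> is \<open>cube_action as (i - 1)\<close>, and \<open>is\<close> below lists the numbers \<open>i\<^sub>1 - 1, \<dots>, i\<^sub>d - 1\<close>.
\<close>

definition cube_action :: "'a list \<Rightarrow> nat \<Rightarrow> 'a \<times> nat" where
  "cube_action as i = (as ! i, Suc i)"

definition cube_states :: "nat \<Rightarrow> nat list set" where
  "cube_states n = {\<epsilon>. length \<epsilon> = n \<and> set \<epsilon> \<subseteq> {0, 1}}"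

definition cube :: "'a list \<Rightarrow> (nat list, 'a \<times> nat, 'a) ts" where
  "cube as = \<lparr>
     states = cube_states (length as),
     actions = cube_action as ` {..<length as},
     label = fst,
     transitions = {(\<epsilon>, map (cube_action as) is, \<epsilon>') | \<epsilon> is \<epsilon>'.
       \<epsilon> \<in> cube_states (length as) \<and> \<epsilon>' \<in> cube_states (length as) \<and>
       1 \<le> length is \<and> distinct is \<and> set is \<subseteq> {..<length as} \<and>
       (\<forall>i < length as. \<epsilon> ! i \<le> \<epsilon>' ! i) \<and>
       (\<forall>i < length as. \<epsilon> ! i \<noteq> \<epsilon>' ! i \<longleftrightarrow> i \<in> set is)} \<rparr>"

definition cube_ext :: "'a list \<Rightarrow> (nat list, 'a \<times> nat, 'a) ts" where
  "cube_ext as = \<lparr>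
     states = {replicate (length as) 0, replicate (length as) 1},
     actions = cube_action as ` {..<length as},
     label = fst,
     transitions = {(replicate (length as) 0,
               map (\<lambda>i. cube_action as (\<sigma> i)) [0..<length as],
               replicate (length as) 1) | \<sigma>. \<sigma> permutes {..<length as}} \<rparr>"

text \<open>
  The states \<open>0, 1\<close> of \<open>D[a]\<close> are encoded as the one-element lists \<open>[0], [1]\<close>, so that \<open>D[a]\<close> has
  the same type as the cubes.
\<close>

definition double :: "'a \<Rightarrow> (nat list, 'a \<times> nat, 'a) ts" where
  "double a = \<lparr>
     states = {[0], [1]},
     actions = {(a, 1), (a, 2)},
     label = fst,
     transitions = {([0], [(a, 1)], [1]), ([0], [(a, 2)], [1])} \<rparr>"

definition inclusion :: "('s, 'l, 'a) ts \<Rightarrow> ('s \<Rightarrow> 's) \<times> ('l \<Rightarrow> 'l)" where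
  "inclusion X = (restrict id (states X), restrict id (actions X))"

definition cube_morphisms :: "'a set \<Rightarrow> (nat list, 'a \<times> nat, 'a) ts_mor set" where
  "cube_morphisms \<Sigma> =
     {(double a, f, cube [a]) | a f. a \<in> \<Sigma> \<and> f \<in> hom (double a) (cube [a])} \<union>
     {(cube_ext as, inclusion (cube_ext as), cube as) | as. 2 \<le> length as \<and> set as \<subseteq> \<Sigma>}"

end

theory Submission
  imports Defs
begin

text \<open>
  Why a cube is the right test object: let \<open>C\<close> be a weak higher dimensional transition system and
  \<open>(\<alpha>, u\<^sub>1, \<dots>, u\<^sub>n, \<beta>)\<close> one of its transitions. By the multiset axiom only the multiset of the actions
  matters, so such a transition is the same thing as a map from the extended cube to \<open>C\<close>. To extend
  this map to the cube one has to choose, for each set \<open>K\<close> of coordinates that is neither empty nor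
  full, the image \<open>\<nu>\<^sub>K\<close> of the vertex with ones at \<open>K\<close>. Clearly \<open>\<nu>\<^sub>K\<close> must be an intermediate state:
  \<open>u\<^sub>K\<close> leads from \<open>\<alpha>\<close> to \<open>\<nu>\<^sub>K\<close>, and the remaining actions lead from \<open>\<nu>\<^sub>K\<close> to \<open>\<beta>\<close>. The coherence axiom
  says precisely that this is enough, because it provides the transitions from \<open>\<nu>\<^sub>K\<close> to \<open>\<nu>\<^sub>L\<close> for
  \<open>K \<subset> L\<close>. This is lemma \<open>hom_cube_iff_intermediate\<close>.

  Hence the extensions of the map are exactly the families \<open>(\<nu>\<^sub>K)\<^sub>K\<close> of intermediate states, chosen
  independently of each other. There is exactly one family if and only if there is exactly one choice
  for each \<open>K\<close>. For all transitions together this says that orthogonality to the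
  inclusions of extended cubes is the existence and uniqueness of intermediate states
  (lemmas \<open>orthogonal_if_unique_intermediate\<close> and \<open>unique_intermediate_if_orthogonal\<close>), which is
  CSA2. In the same way a map from \<open>D[a]\<close> is a pair of parallel transitions with label \<open>a\<close>, and it
  factors through \<open>C\<^sub>1[a]\<close> if and only if their actions agree, so orthogonality to the collapse
  maps is CSA1. Finally, in the presence of CSA2, the coherence axiom and CSA3 imply each other, so
  that CSA3 imposes nothing further on a weak system (lemma \<open>hdts_iff\<close>).
\<close>

section \<open>Transitions along multisets of actions\<close>

text \<open>
  The multiset axiom makes the order of the actions irrelevant. With multisets, the repeated
  splitting and reordering of lists of actions turns into addition.
\<close>

definition mtrans :: "('s, 'l, 'a) ts \<Rightarrow> 's \<Rightarrow> 'l multiset \<Rightarrow> 's \<Rightarrow> bool" where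
  "mtrans C \<alpha> A \<beta> \<longleftrightarrow> (\<exists>us. mset us = A \<and> (\<alpha>, us, \<beta>) \<in> transitions C)"

lemma mtrans_mset_iff:
  assumes "multiset_axiom C"
  shows "mtrans C \<alpha> (mset us) \<beta> \<longleftrightarrow> (\<alpha>, us, \<beta>) \<in> transitions C"
proof
  assume "mtrans C \<alpha> (mset us) \<beta>"
  then obtain vs where vs: "mset us = mset vs" "(\<alpha>, vs, \<beta>) \<in> transitions C"
    unfolding mtrans_def by metis
  obtain \<sigma> where \<sigma>: "\<sigma> permutes {..<length vs}" "permute_list \<sigma> vs = us"
    using mset_eq_permutation[OF vs(1)] by blast
  show "(\<alpha>, us, \<beta>) \<in> transitions C"
  proof (cases "2 \<le> length vs")
    case True
    then show ?thesis
      using assms vs(2) \<sigma> unfolding multiset_axiom_def by metis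
  next
    case False
    then have "length us = 0 \<or> length us = 1"
      using mset_eq_length[OF vs(1)] by linarith
    then have "us = vs"
      using vs(1) by (auto simp: length_Suc_conv)
    with vs(2) show ?thesis by simp
  qed
qed (auto simp: mtrans_def)

lemma mtrans_states:
  assumes "ts_carrier \<Sigma> C" "mtrans C \<alpha> A \<beta>"
  shows "\<alpha> \<in> states C" "\<beta> \<in> states C"
  using assms unfolding ts_carrier_def mtrans_def by blast+

text \<open>
  The coherence axiom for blocks of actions that need not be contiguous in a given list: the
  multiset axiom moves them into the order \<open>A\<close>, \<open>B\<close>, \<open>D\<close>.
\<close>

lemma mtrans_coherence:
  assumes "multiset_axiom C" "coherence_axiom C"
    and ne: "A \<noteq> {#}" "B \<noteq> {#}" "D \<noteq> {#}"
    and tr: "mtrans C \<alpha> (A + B + D) \<beta>" "mtrans C \<alpha> A \<nu>1" "mtrans C \<nu>1 (B + D) \<beta>"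
      "mtrans C \<alpha> (A + B) \<nu>2" "mtrans C \<nu>2 D \<beta>"
  shows "mtrans C \<nu>1 B \<nu>2"
proof -
  obtain as bs ds where ms: "A = mset as" "B = mset bs" "D = mset ds"
    by (metis ex_mset)
  have "as \<noteq> []" "bs \<noteq> []" "ds \<noteq> []"
    using ne ms by auto
  then have "1 \<le> length as" "1 \<le> length bs" "1 \<le> length ds"
    by (simp_all add: Suc_le_eq)
  then have len: "3 \<le> length (as @ bs @ ds) \<and> 1 \<le> length as \<and> 1 \<le> length bs
      \<and> length as + length bs < length (as @ bs @ ds)"
    by auto
  have "(\<alpha>, as @ bs @ ds, \<beta>) \<in> transitions C" "(\<alpha>, as, \<nu>1) \<in> transitions C"
    "(\<nu>1, bs @ ds, \<beta>) \<in> transitions C" "(\<alpha>, as @ bs, \<nu>2) \<in> transitions C"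
    "(\<nu>2, ds, \<beta>) \<in> transitions C"
    using tr unfolding ms mtrans_mset_iff[OF assms(1), symmetric] by (simp_all add: add.assoc)
  then have "(\<nu>1, take (length bs) (drop (length as) (as @ bs @ ds)), \<nu>2) \<in> transitions C"
    using assms(2)[unfolded coherence_axiom_def, rule_format, of "as @ bs @ ds" "length as" "length bs"] len
    by simp
  then show ?thesis
    unfolding ms mtrans_mset_iff[OF assms(1)] by simp
qed

text \<open>
  CSA2 without positions. Its second half, where the two blocks are exchanged, is the first
  half for \<open>B + A\<close>.
\<close>

definition unique_intermediate :: "('s, 'l, 'a) ts \<Rightarrow> bool" where
  "unique_intermediate C \<longleftrightarrow>
     (\<forall>\<alpha> A B \<beta>. A \<noteq> {#} \<and> B \<noteq> {#} \<and> mtrans C \<alpha> (A + B) \<beta> \<longrightarrow>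
        (\<exists>!\<nu>. mtrans C \<alpha> A \<nu> \<and> mtrans C \<nu> B \<beta>))"

lemma unique_intermediateD:
  assumes "unique_intermediate C" "A \<noteq> {#}" "B \<noteq> {#}" "mtrans C \<alpha> (A + B) \<beta>"
  shows "\<exists>!\<nu>. mtrans C \<alpha> A \<nu> \<and> mtrans C \<nu> B \<beta>"
  using assms unfolding unique_intermediate_def by blast

lemma CSA2_iff_unique_intermediate:
  assumes "ts_carrier \<Sigma> C" "multiset_axiom C"
  shows "CSA2 C \<longleftrightarrow> unique_intermediate C"
proof
  assume csa2: "CSA2 C"
  show "unique_intermediate C"
    unfolding unique_intermediate_def
  proof (intro allI impI, elim conjE)
    fix \<alpha> A B \<beta>
    assume ne: "A \<noteq> {#}" "B \<noteq> {#}" and tr: "mtrans C \<alpha> (A + B) \<beta>"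
    obtain as bs where ms: "A = mset as" "B = mset bs"
      by (metis ex_mset)
    have "1 \<le> length as" "1 \<le> length bs"
      using ne ms by (auto simp: Suc_le_eq)
    then have len: "2 \<le> length (as @ bs) \<and> 1 \<le> length as \<and> length as < length (as @ bs)"
      by auto
    have "(\<alpha>, as @ bs, \<beta>) \<in> transitions C"
      using tr by (simp add: ms flip: mtrans_mset_iff[OF assms(2)])
    then have "\<exists>!\<nu>. \<nu> \<in> states C \<and> (\<alpha>, take (length as) (as @ bs), \<nu>) \<in> transitions C \<and>
        (\<nu>, drop (length as) (as @ bs), \<beta>) \<in> transitions C"
      using csa2[unfolded CSA2_def, rule_format, of "as @ bs" "length as" \<alpha> \<beta>] len by blast
    then show "\<exists>!\<nu>. mtrans C \<alpha> A \<nu> \<and> mtrans C \<nu> B \<beta>"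
      unfolding ms mtrans_mset_iff[OF assms(2)] using assms(1) unfolding ts_carrier_def
      by simp blast
  qed
next
  assume uni: "unique_intermediate C"
  show "CSA2 C"
    unfolding CSA2_def
  proof (intro allI impI, elim conjE)
    fix \<alpha> \<beta> us p
    assume p: "2 \<le> length us" "1 \<le> p" "p < length us" and tr: "(\<alpha>, us, \<beta>) \<in> transitions C"
    have ne: "mset (take p us) \<noteq> {#}" "mset (drop p us) \<noteq> {#}"
      using p by auto
    have sum: "mset us = mset (take p us) + mset (drop p us)"
      by (simp flip: mset_append)
    have st: "\<nu> \<in> states C" if "mtrans C \<alpha> A \<nu>" for \<nu> A
      using mtrans_states(2)[OF assms(1) that] .
    have "mtrans C \<alpha> (mset (take p us) + mset (drop p us)) \<beta>"
      "mtrans C \<alpha> (mset (drop p us) + mset (take p us)) \<beta>"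
      using tr unfolding mtrans_mset_iff[OF assms(2), symmetric] sum by (simp_all add: add.commute)
    from this[THEN unique_intermediateD[OF uni, rotated 2]] ne
    show "(\<exists>!\<nu>1. \<nu>1 \<in> states C \<and> (\<alpha>, take p us, \<nu>1) \<in> transitions C \<and>
             (\<nu>1, drop p us, \<beta>) \<in> transitions C) \<and>
          (\<exists>!\<nu>2. \<nu>2 \<in> states C \<and> (\<alpha>, drop p us, \<nu>2) \<in> transitions C \<and>
             (\<nu>2, take p us, \<beta>) \<in> transitions C)"
      unfolding mtrans_mset_iff[OF assms(2), symmetric] using st by metis
  qed
qed

text \<open>
  CSA2 supplies the two missing vertices: a state \<open>x\<close> between \<open>\<nu>1\<close> and \<open>\<beta>\<close>, and a state \<open>y\<close>
  between \<open>\<alpha>\<close> and \<open>\<nu>2\<close>. The paths \<open>\<alpha>, \<nu>1, x, \<beta>\<close> and \<open>\<alpha>, y, \<nu>2, \<beta>\<close> then use the same three blocks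
  of actions, and CSA3 identifies them.
\<close>

lemma coherence_axiom_if_hdts:
  assumes "hdts \<Sigma> C"
  shows "coherence_axiom C"
  unfolding coherence_axiom_def
proof (intro allI impI, elim conjE)
  fix \<alpha> us \<beta> \<nu>1 \<nu>2 p q
  assume len: "3 \<le> length us" "1 \<le> p" "1 \<le> q" "p + q < length us"
    and tr: "(\<alpha>, us, \<beta>) \<in> transitions C"
      "(\<alpha>, take p us, \<nu>1) \<in> transitions C" "(\<nu>1, drop p us, \<beta>) \<in> transitions C"
      "(\<alpha>, take (p + q) us, \<nu>2) \<in> transitions C" "(\<nu>2, drop (p + q) us, \<beta>) \<in> transitions C"
  have lens: "2 \<le> length (drop p us) \<and> 1 \<le> q \<and> q < length (drop p us)"
    "2 \<le> length (take (p + q) us) \<and> 1 \<le> p \<and> p < length (take (p + q) us)"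
    using len by auto
  have csa: "CSA2 C" "CSA3 C"
    using assms unfolding hdts_def by auto
  obtain x where x: "(\<nu>1, take q (drop p us), x) \<in> transitions C"
    "(x, drop (p + q) us, \<beta>) \<in> transitions C"
    using csa(1)[unfolded CSA2_def, rule_format, of "drop p us" q \<nu>1 \<beta>] lens tr(3)
    by (auto simp: add.commute)
  obtain y where y: "(\<alpha>, take p us, y) \<in> transitions C"
    "(y, take q (drop p us), \<nu>2) \<in> transitions C"
    using csa(1)[unfolded CSA2_def, rule_format, of "take (p + q) us" p \<alpha> \<nu>2] lens tr(4)
    by (auto simp: drop_take)
  have "\<nu>1 = y \<and> x = \<nu>2"
    using csa(2)[unfolded CSA3_def, rule_format, of p q us \<alpha> \<beta> \<nu>1 x \<nu>2 y] len tr x y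
    by blast
  then show "(\<nu>1, take q (drop p us), \<nu>2) \<in> transitions C"
    using x by simp
qed

text \<open>
  Coherence joins the first path to the second by a transition from \<open>\<nu>1\<close> to \<open>\<nu>2'\<close>. Thus \<open>\<nu>2\<close> and
  \<open>\<nu>2'\<close> both lie between \<open>\<nu>1\<close> and \<open>\<beta>\<close>, while \<open>\<nu>1\<close> and \<open>\<nu>1'\<close> both lie between \<open>\<alpha>\<close> and \<open>\<nu>2'\<close>, and the
  uniqueness in CSA2 identifies them.
\<close>

lemma CSA3_if_coherent:
  assumes "ts_carrier \<Sigma> C" "CSA2 C" "coherence_axiom C"
  shows "CSA3 C"
  unfolding CSA3_def
proof (intro allI impI, elim conjE)
  fix \<alpha> us \<beta> \<nu>1 \<nu>2 \<nu>1' \<nu>2' p q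
  assume len: "1 \<le> p" "1 \<le> q" "p + q < length us"
    and tr: "(\<alpha>, us, \<beta>) \<in> transitions C"
      "(\<alpha>, take p us, \<nu>1) \<in> transitions C" "(\<nu>1, drop p us, \<beta>) \<in> transitions C"
      "(\<nu>1, take q (drop p us), \<nu>2) \<in> transitions C" "(\<nu>2, drop (p + q) us, \<beta>) \<in> transitions C"
      "(\<alpha>, take (p + q) us, \<nu>2') \<in> transitions C" "(\<nu>2', drop (p + q) us, \<beta>) \<in> transitions C"
      "(\<alpha>, take p us, \<nu>1') \<in> transitions C" "(\<nu>1', take q (drop p us), \<nu>2') \<in> transitions C"
  have st: "\<nu> \<in> states C" if "(\<alpha>', vs, \<nu>) \<in> transitions C" for \<alpha>' vs \<nu>
    using assms(1) that unfolding ts_carrier_def by blast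
  have mid: "(\<nu>1, take q (drop p us), \<nu>2') \<in> transitions C"
    using assms(3)[unfolded coherence_axiom_def, rule_format, of us p q \<alpha> \<beta> \<nu>1 \<nu>2'] len tr
    by simp
  have lens: "2 \<le> length (drop p us) \<and> 1 \<le> q \<and> q < length (drop p us)"
    "2 \<le> length (take (p + q) us) \<and> 1 \<le> p \<and> p < length (take (p + q) us)"
    using len by auto
  have "\<exists>!\<nu>. \<nu> \<in> states C \<and> (\<nu>1, take q (drop p us), \<nu>) \<in> transitions C
      \<and> (\<nu>, drop (p + q) us, \<beta>) \<in> transitions C"
    using assms(2)[unfolded CSA2_def, rule_format, of "drop p us" q \<nu>1 \<beta>] lens tr(3)
    by (simp add: add.commute)
  then have "\<nu>2 = \<nu>2'"
    using mid tr st by metis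
  moreover have "\<exists>!\<nu>. \<nu> \<in> states C \<and> (\<alpha>, take p us, \<nu>) \<in> transitions C
      \<and> (\<nu>, take q (drop p us), \<nu>2') \<in> transitions C"
    using assms(2)[unfolded CSA2_def, rule_format, of "take (p + q) us" p \<alpha> \<nu>2'] lens tr(6)
    by (simp add: drop_take)
  then have "\<nu>1 = \<nu>1'"
    using mid tr st by metis
  ultimately show "\<nu>1 = \<nu>1' \<and> \<nu>2 = \<nu>2'" by simp
qed

lemma hdts_iff:
  "hdts \<Sigma> C \<longleftrightarrow> whdts \<Sigma> C \<and> CSA1 C \<and> unique_intermediate C"
  using coherence_axiom_if_hdts[of \<Sigma> C] CSA3_if_coherent[of \<Sigma> C] CSA2_iff_unique_intermediate[of \<Sigma> C]
  unfolding hdts_def whdts_def by blast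

section \<open>The transitions of a cube\<close>

text \<open>
  Vertices of the cube are handled as subsets of the set of coordinates, so that the order
  on vertices becomes inclusion.
\<close>

definition ones :: "nat list \<Rightarrow> nat set" where
  "ones \<epsilon> = {i. i < length \<epsilon> \<and> \<epsilon> ! i = 1}"

lemma cube_state_nth:
  assumes "\<epsilon> \<in> cube_states n" "i < n"
  shows "\<epsilon> ! i = of_bool (i \<in> ones \<epsilon>)"
proof -
  have "length \<epsilon> = n" "\<epsilon> ! i \<in> set \<epsilon>" "set \<epsilon> \<subseteq> {0, 1}"
    using assms unfolding cube_states_def by auto
  then show ?thesis
    using assms(2) unfolding ones_def by (fastforce simp: of_bool_def)
qed

lemma ones_eq_iff:
  assumes "\<epsilon> \<in> cube_states n" "\<epsilon>' \<in> cube_states n"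
  shows "ones \<epsilon> = ones \<epsilon>' \<longleftrightarrow> \<epsilon> = \<epsilon>'"
proof
  assume "ones \<epsilon> = ones \<epsilon>'"
  then show "\<epsilon> = \<epsilon>'"
    using assms cube_state_nth[OF assms(1)] cube_state_nth[OF assms(2)]
    by (intro nth_equalityI) (auto simp: cube_states_def)
qed simp

lemma ones_subset: "\<epsilon> \<in> cube_states n \<Longrightarrow> ones \<epsilon> \<subseteq> {..<n}"
  unfolding ones_def cube_states_def by auto

lemma ones_replicate:
  "ones (replicate n 0) = {}" "ones (replicate n 1) = {..<n}"
  unfolding ones_def by auto

lemma replicate_in_cube_states:
  "replicate n 0 \<in> cube_states n" "replicate n 1 \<in> cube_states n"
  unfolding cube_states_def by auto

lemma ex_cube_state:
  assumes "K \<subseteq> {..<n}"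
  shows "\<exists>\<epsilon> \<in> cube_states n. ones \<epsilon> = K"
proof
  show "map (\<lambda>i. of_bool (i \<in> K)) [0..<n] \<in> cube_states n"
    unfolding cube_states_def by auto
  show "ones (map (\<lambda>i. of_bool (i \<in> K)) [0..<n]) = K"
    using assms unfolding ones_def by (auto simp: of_bool_def split: if_splits)
qed

lemma inj_cube_action: "inj (cube_action as)"
  unfolding cube_action_def by (rule injI) simp

text \<open>
  Since the directions of a transition of the cube are determined by its end points, the
  transitions from \<open>\<epsilon>\<close> to \<open>\<epsilon>'\<close> are just the enumerations of a difference of sets.
\<close>

lemma cube_transitions_iff:
  "(\<epsilon>, us, \<epsilon>') \<in> transitions (cube as) \<longleftrightarrow>
     \<epsilon> \<in> cube_states (length as) \<and> \<epsilon>' \<in> cube_states (length as) \<and> ones \<epsilon> \<subset> ones \<epsilon>' \<and>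
     (\<exists>is. us = map (cube_action as) is \<and> distinct is \<and> set is = ones \<epsilon>' - ones \<epsilon>)"
  (is "?L \<longleftrightarrow> ?R")
proof -
  let ?n = "length as"
  have key: "1 \<le> length is \<and> set is \<subseteq> {..<?n} \<and> (\<forall>i < ?n. \<epsilon> ! i \<le> \<epsilon>' ! i) \<and>
       (\<forall>i < ?n. \<epsilon> ! i \<noteq> \<epsilon>' ! i \<longleftrightarrow> i \<in> set is) \<longleftrightarrow>
       ones \<epsilon> \<subset> ones \<epsilon>' \<and> set is = ones \<epsilon>' - ones \<epsilon>"
    if st: "\<epsilon> \<in> cube_states ?n" "\<epsilon>' \<in> cube_states ?n" for "is" :: "nat list"
  proof -
    note sub = ones_subset[OF st(1)] ones_subset[OF st(2)]
    have le: "(\<forall>i < ?n. \<epsilon> ! i \<le> \<epsilon>' ! i) \<longleftrightarrow> ones \<epsilon> \<subseteq> ones \<epsilon>'"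
      using sub cube_state_nth[OF st(1)] cube_state_nth[OF st(2)] by fastforce
    have neq: "(\<forall>i < ?n. \<epsilon> ! i \<noteq> \<epsilon>' ! i \<longleftrightarrow> i \<in> set is) \<longleftrightarrow>
        (\<forall>i < ?n. (i \<in> ones \<epsilon>) \<noteq> (i \<in> ones \<epsilon>') \<longleftrightarrow> i \<in> set is)"
      using cube_state_nth[OF st(1)] cube_state_nth[OF st(2)] by (auto simp: of_bool_def)
    have len: "1 \<le> length is \<longleftrightarrow> set is \<noteq> {}"
      by (cases "is") auto
    show ?thesis
      unfolding le neq len
    proof (intro iffI conjI; elim conjE)
      assume *: "ones \<epsilon> \<subseteq> ones \<epsilon>'" "set is \<noteq> {}" "set is \<subseteq> {..<?n}"
        "\<forall>i < ?n. (i \<in> ones \<epsilon>) \<noteq> (i \<in> ones \<epsilon>') \<longleftrightarrow> i \<in> set is"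
      then show "set is = ones \<epsilon>' - ones \<epsilon>"
        using sub by blast
      with *(1,2) show "ones \<epsilon> \<subset> ones \<epsilon>'"
        by auto
    next
      assume *: "ones \<epsilon> \<subset> ones \<epsilon>'" "set is = ones \<epsilon>' - ones \<epsilon>"
      show "set is \<noteq> {}" "set is \<subseteq> {..<?n}" "ones \<epsilon> \<subseteq> ones \<epsilon>'"
        "\<forall>i < ?n. (i \<in> ones \<epsilon>) \<noteq> (i \<in> ones \<epsilon>') \<longleftrightarrow> i \<in> set is"
        using * sub(2) by (auto dest: psubsetD)
    qed
  qed
  show ?thesis
  proof -
    have "?L \<longleftrightarrow> \<epsilon> \<in> cube_states ?n \<and> \<epsilon>' \<in> cube_states ?n \<and>
        (\<exists>is. us = map (cube_action as) is \<and> distinct is \<and>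
          (1 \<le> length is \<and> set is \<subseteq> {..<?n} \<and> (\<forall>i < ?n. \<epsilon> ! i \<le> \<epsilon>' ! i) \<and>
           (\<forall>i < ?n. \<epsilon> ! i \<noteq> \<epsilon>' ! i \<longleftrightarrow> i \<in> set is)))"
      unfolding cube_def by simp blast
    also have "\<dots> \<longleftrightarrow> \<epsilon> \<in> cube_states ?n \<and> \<epsilon>' \<in> cube_states ?n \<and>
        (\<exists>is. us = map (cube_action as) is \<and> distinct is \<and>
          (ones \<epsilon> \<subset> ones \<epsilon>' \<and> set is = ones \<epsilon>' - ones \<epsilon>))"
      by (intro conj_cong refl) (simp only: key)
    finally show ?thesis by blast
  qed
qed

lemma cube_transitions_map_iff:
  "(\<epsilon>, map (cube_action as) is, \<epsilon>') \<in> transitions (cube as) \<longleftrightarrow>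
     \<epsilon> \<in> cube_states (length as) \<and> \<epsilon>' \<in> cube_states (length as) \<and> ones \<epsilon> \<subset> ones \<epsilon>' \<and>
     distinct is \<and> set is = ones \<epsilon>' - ones \<epsilon>"
  unfolding cube_transitions_iff by (auto simp: inj_map_eq_map[OF inj_cube_action])

lemma cube_ext_transitions_iff:
  "(\<epsilon>, us, \<epsilon>') \<in> transitions (cube_ext as) \<longleftrightarrow>
     \<epsilon> = replicate (length as) 0 \<and> \<epsilon>' = replicate (length as) 1 \<and>
     (\<exists>is. us = map (cube_action as) is \<and> distinct is \<and> set is = {..<length as})"
proof -
  let ?n = "length as"
  have "(\<exists>\<sigma>. us = map (\<lambda>i. cube_action as (\<sigma> i)) [0..<?n] \<and> \<sigma> permutes {..<?n}) \<longleftrightarrow>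
     (\<exists>is. us = map (cube_action as) is \<and> distinct is \<and> set is = {..<?n})" (is "?L \<longleftrightarrow> ?R")
  proof
    assume ?L
    then obtain \<sigma> where \<sigma>: "us = map (\<lambda>i. cube_action as (\<sigma> i)) [0..<?n]" "\<sigma> permutes {..<?n}"
      by blast
    then have "distinct (map \<sigma> [0..<?n])" "set (map \<sigma> [0..<?n]) = {..<?n}"
      using permutes_inj_on[OF \<sigma>(2)] permutes_image[OF \<sigma>(2)]
      by (auto simp: distinct_map lessThan_atLeast0)
    then show ?R
      using \<sigma>(1) by (intro exI[of _ "map \<sigma> [0..<?n]"]) (simp add: comp_def)
  next
    assume ?R
    then obtain "is" where idx: "us = map (cube_action as) is" "distinct is" "set is = {..<?n}"
      by blast
    then have "mset is = mset [0..<?n]"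
      by (metis atLeast0LessThan distinct_upt set_eq_iff_mset_eq_distinct set_upt)
    then obtain \<sigma> where \<sigma>: "\<sigma> permutes {..<?n}" "permute_list \<sigma> [0..<?n] = is"
      using mset_eq_permutation by (metis diff_zero length_upt)
    have "is = map \<sigma> [0..<?n]"
      unfolding \<sigma>(2)[symmetric] permute_list_def
      using permutes_in_image[OF \<sigma>(1)] by auto
    then show ?L
      using idx(1) \<sigma>(1) by auto
  qed
  then show ?thesis
    unfolding cube_ext_def by auto
qed

lemma permute_distinct_map:
  assumes "\<sigma> permutes {..<length (map f is)}" "distinct is"
  shows "\<exists>js. permute_list \<sigma> (map f is) = map f js \<and> distinct js \<and> set js = set is"
  using assms by (intro exI[of _ "permute_list \<sigma> is"]) (simp add: permute_list_map)

text \<open>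
  For the coherence axiom, the block between \<open>p\<close> and \<open>p + q\<close> consists of the directions that
  are in \<open>ones \<nu>2\<close> and not in \<open>ones \<nu>1\<close>, as both vertices are reached from \<open>\<alpha>\<close>.
\<close>

lemma whdts_cube:
  assumes "set as \<subseteq> \<Sigma>"
  shows "whdts \<Sigma> (cube as)"
  unfolding whdts_def
proof (intro conjI)
  show "ts_carrier \<Sigma> (cube as)"
    unfolding ts_carrier_def
  proof (intro conjI allI impI)
    show "label (cube as) \<in> actions (cube as) \<rightarrow> \<Sigma>"
      using assms by (auto simp: cube_def cube_action_def)
    show "set us \<subseteq> actions (cube as)" if "(\<alpha>, us, \<beta>) \<in> transitions (cube as)" for \<alpha> us \<beta>
      using that unfolding cube_def by fastforce
  qed (auto simp: cube_def Suc_le_eq)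
  show "multiset_axiom (cube as)"
    unfolding multiset_axiom_def cube_transitions_iff
    using permute_distinct_map by metis
  show "coherence_axiom (cube as)"
    unfolding coherence_axiom_def
  proof (intro allI impI, elim conjE)
    fix \<alpha> us \<beta> \<nu>1 \<nu>2 p q
    assume len: "1 \<le> q" "p + q < length us"
      and tr: "(\<alpha>, us, \<beta>) \<in> transitions (cube as)"
        "(\<alpha>, take p us, \<nu>1) \<in> transitions (cube as)"
        "(\<alpha>, take (p + q) us, \<nu>2) \<in> transitions (cube as)"
    from tr(1) obtain "is" where idx: "us = map (cube_action as) is" "distinct is"
      unfolding cube_transitions_iff by blast
    let ?mid = "take q (drop p is)"
    have cond: "ones \<alpha> \<subset> ones \<nu>1" "set (take p is) = ones \<nu>1 - ones \<alpha>"
      "ones \<alpha> \<subset> ones \<nu>2" "set (take (p + q) is) = ones \<nu>2 - ones \<alpha>"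
      "\<nu>1 \<in> cube_states (length as)" "\<nu>2 \<in> cube_states (length as)"
      using tr unfolding idx(1) take_map cube_transitions_map_iff by auto
    have "distinct (take p is @ ?mid)"
      using idx(2) by (simp flip: take_add)
    then have disj: "set (take p is) \<inter> set ?mid = {}" "distinct ?mid"
      by auto
    have un: "set (take (p + q) is) = set (take p is) \<union> set ?mid"
      by (simp add: take_add)
    have "set ?mid \<noteq> {}"
      using len idx(1) by auto
    have vertices: "set (take p is) \<union> ones \<alpha> = ones \<nu>1" "set (take (p + q) is) \<union> ones \<alpha> = ones \<nu>2"
      "set (take (p + q) is) \<inter> ones \<alpha> = {}"
      using cond by auto
    have diff: "set ?mid = ones \<nu>2 - ones \<nu>1"
      using vertices(3) disj(1) unfolding vertices(1,2)[symmetric] un by auto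
    have "ones \<nu>1 \<subseteq> ones \<nu>2"
      unfolding vertices(1,2)[symmetric] un by auto
    moreover have "ones \<nu>1 \<noteq> ones \<nu>2"
      using diff \<open>set ?mid \<noteq> {}\<close> by (metis Diff_cancel)
    ultimately show "(\<nu>1, take q (drop p us), \<nu>2) \<in> transitions (cube as)"
      using cond(5,6) disj(2) diff unfolding idx(1) take_map drop_map cube_transitions_map_iff
      by (simp add: psubset_eq)
  qed
qed

lemma whdts_cube_ext:
  assumes "set as \<subseteq> \<Sigma>" "as \<noteq> []"
  shows "whdts \<Sigma> (cube_ext as)"
  unfolding whdts_def
proof (intro conjI)
  show "ts_carrier \<Sigma> (cube_ext as)"
    unfolding ts_carrier_def
  proof (intro conjI allI impI)
    show "label (cube_ext as) \<in> actions (cube_ext as) \<rightarrow> \<Sigma>"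
      using assms by (auto simp: cube_ext_def cube_action_def)
    show "set us \<subseteq> actions (cube_ext as)" if "(\<alpha>, us, \<beta>) \<in> transitions (cube_ext as)" for \<alpha> us \<beta>
      using that unfolding cube_ext_transitions_iff by (auto simp: cube_ext_def)
  qed (use assms(2) in \<open>auto simp: cube_ext_def Suc_le_eq\<close>)
  show "multiset_axiom (cube_ext as)"
    unfolding multiset_axiom_def cube_ext_transitions_iff
    using permute_distinct_map by metis
  have len: "length us = length as" if "(\<epsilon>, us, \<epsilon>') \<in> transitions (cube_ext as)" for \<epsilon> us \<epsilon>'
    using that unfolding cube_ext_def by auto
  \<comment> \<open>All transitions have the same length, so none of them is a proper part of another one.\<close>
  show "coherence_axiom (cube_ext as)"
    unfolding coherence_axiom_def
  proof (intro allI impI, elim conjE)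
    fix \<alpha> us \<beta> \<nu>1 \<nu>2 p q
    assume "1 \<le> (q::nat)" "p + q < length us" "(\<alpha>, us, \<beta>) \<in> transitions (cube_ext as)"
      "(\<alpha>, take p us, \<nu>1) \<in> transitions (cube_ext as)"
    then have False
      using len[of \<alpha> us \<beta>] len[of \<alpha> "take p us" \<nu>1] by simp
    then show "(\<nu>1, take q (drop p us), \<nu>2) \<in> transitions (cube_ext as)" ..
  qed
qed

lemma whdts_double:
  assumes "a \<in> \<Sigma>"
  shows "whdts \<Sigma> (double a)"
  using assms unfolding whdts_def ts_carrier_def multiset_axiom_def coherence_axiom_def double_def
  by auto

lemma inclusion_in_hom: "inclusion (cube_ext as) \<in> hom (cube_ext as) (cube as)" if "as \<noteq> []"
proof -
  let ?z = "replicate (length as) (0::nat)" and ?o = "replicate (length as) (1::nat)"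
  have "(?z, map (restrict id (actions (cube_ext as))) (map (cube_action as) is), ?o)
      \<in> transitions (cube as)"
    if "distinct is" "set is = {..<length as}" for "is"
  proof -
    have "map (restrict id (actions (cube_ext as))) (map (cube_action as) is) = map (cube_action as) is"
      using that by (auto simp: cube_ext_def)
    then show ?thesis
      using that \<open>as \<noteq> []\<close> replicate_in_cube_states ones_replicate
      by (simp only: cube_transitions_map_iff) auto
  qed
  then show ?thesis
    unfolding hom_def inclusion_def cube_ext_transitions_iff
    using replicate_in_cube_states by (auto simp: cube_ext_def cube_def)
qed

section \<open>Morphisms out of cubes and extended cubes\<close>

text \<open>
  If \<open>f\<close> is the action part of a map out of the cube, this is the multiset of actions of the
  images of those transitions whose set of directions is \<open>K\<close>.
\<close>

definition edge_actions :: "'a list \<Rightarrow> ('a \<times> nat \<Rightarrow> 'l) \<Rightarrow> nat set \<Rightarrow> 'l multiset" where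
  "edge_actions as f K = image_mset (\<lambda>i. f (cube_action as i)) (mset_set K)"

lemma edge_actions_Un:
  assumes "finite K" "finite K'" "K \<inter> K' = {}"
  shows "edge_actions as f (K \<union> K') = edge_actions as f K + edge_actions as f K'"
  using assms unfolding edge_actions_def by (simp add: mset_set_Union)

lemma edge_actions_split:
  assumes "K \<subseteq> {..<n}"
  shows "edge_actions as f {..<n} = edge_actions as f K + edge_actions as f ({..<n} - K)"
proof -
  have "{..<n} = K \<union> ({..<n} - K)" "finite K"
    using assms finite_subset by auto
  then show ?thesis
    using edge_actions_Un[of K "{..<n} - K" as f] by simp
qed

lemma edge_actions_eq_empty_iff: "finite K \<Longrightarrow> edge_actions as f K = {#} \<longleftrightarrow> K = {}"
  unfolding edge_actions_def by (simp add: mset_set_empty_iff)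

lemma mset_map_edge_actions:
  "distinct is \<Longrightarrow> mset (map f (map (cube_action as) is)) = edge_actions as f (set is)"
  unfolding edge_actions_def by (simp add: mset_set_set comp_def)

text \<open>
  The action parts of maps out of the cube and of maps out of the extended cube satisfy the same
  conditions, because both have the same labelled actions.
\<close>

definition action_map :: "'a list \<Rightarrow> ('s, 'l, 'a) ts \<Rightarrow> ('a \<times> nat \<Rightarrow> 'l) \<Rightarrow> bool" where
  "action_map as C f \<longleftrightarrow> f \<in> actions (cube as) \<rightarrow>\<^sub>E actions C \<and>
     (\<forall>u \<in> actions (cube as). label C (f u) = fst u)"

lemma hom_cube_ext_iff:
  assumes "multiset_axiom C"
  shows "(f0, f1) \<in> hom (cube_ext as) C \<longleftrightarrow>
     f0 \<in> states (cube_ext as) \<rightarrow>\<^sub>E states C \<and> action_map as C f1 \<and>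
     mtrans C (f0 (replicate (length as) 0)) (edge_actions as f1 {..<length as})
       (f0 (replicate (length as) 1))"
proof -
  let ?z = "replicate (length as) (0::nat)" and ?o = "replicate (length as) (1::nat)"
  have "(\<forall>\<alpha> us \<beta>. (\<alpha>, us, \<beta>) \<in> transitions (cube_ext as) \<longrightarrow>
      (f0 \<alpha>, map f1 us, f0 \<beta>) \<in> transitions C) \<longleftrightarrow>
     (\<forall>is. distinct is \<and> set is = {..<length as} \<longrightarrow>
        mtrans C (f0 ?z) (mset (map f1 (map (cube_action as) is))) (f0 ?o))"
    unfolding cube_ext_transitions_iff mtrans_mset_iff[OF assms] by blast
  also have "\<dots> \<longleftrightarrow> (\<forall>is. distinct is \<and> set is = {..<length as} \<longrightarrow>
        mtrans C (f0 ?z) (edge_actions as f1 {..<length as}) (f0 ?o))"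
    by (metis mset_map_edge_actions)
  also have "\<dots> \<longleftrightarrow> mtrans C (f0 ?z) (edge_actions as f1 {..<length as}) (f0 ?o)"
    using distinct_upt[of 0 "length as"] set_upt[of 0 "length as"] unfolding lessThan_atLeast0 by blast
  finally show ?thesis
    unfolding hom_def action_map_def by (auto simp: cube_ext_def cube_def)
qed

lemma hom_cube_iff:
  assumes "multiset_axiom C"
  shows "(g0, g1) \<in> hom (cube as) C \<longleftrightarrow>
     g0 \<in> states (cube as) \<rightarrow>\<^sub>E states C \<and> action_map as C g1 \<and>
     (\<forall>\<epsilon> \<in> cube_states (length as). \<forall>\<epsilon>' \<in> cube_states (length as). ones \<epsilon> \<subset> ones \<epsilon>' \<longrightarrow>
        mtrans C (g0 \<epsilon>) (edge_actions as g1 (ones \<epsilon>' - ones \<epsilon>)) (g0 \<epsilon>'))"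
proof -
  let ?S = "cube_states (length as)"
  have ex: "\<exists>is. distinct is \<and> set is = ones \<epsilon>' - ones \<epsilon>" if "\<epsilon>' \<in> ?S" for \<epsilon> \<epsilon>'
  proof -
    have "finite (ones \<epsilon>' - ones \<epsilon>)"
      using finite_subset[OF ones_subset[OF that]] by simp
    then show ?thesis
      using finite_distinct_list by blast
  qed
  have "(\<forall>\<alpha> us \<beta>. (\<alpha>, us, \<beta>) \<in> transitions (cube as) \<longrightarrow>
      (g0 \<alpha>, map g1 us, g0 \<beta>) \<in> transitions C) \<longleftrightarrow>
     (\<forall>\<epsilon> \<in> ?S. \<forall>\<epsilon>' \<in> ?S. ones \<epsilon> \<subset> ones \<epsilon>' \<longrightarrow> (\<forall>is. distinct is \<and> set is = ones \<epsilon>' - ones \<epsilon> \<longrightarrow>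
        mtrans C (g0 \<epsilon>) (mset (map g1 (map (cube_action as) is))) (g0 \<epsilon>')))"
    unfolding cube_transitions_iff mtrans_mset_iff[OF assms] by blast
  also have "\<dots> \<longleftrightarrow> (\<forall>\<epsilon> \<in> ?S. \<forall>\<epsilon>' \<in> ?S. ones \<epsilon> \<subset> ones \<epsilon>' \<longrightarrow>
      mtrans C (g0 \<epsilon>) (edge_actions as g1 (ones \<epsilon>' - ones \<epsilon>)) (g0 \<epsilon>'))"
    using ex by (metis mset_map_edge_actions)
  finally show ?thesis
    unfolding hom_def action_map_def by (auto simp: cube_def)
qed

text \<open>
  The vertices that the cube has in addition to those of the extended cube.
\<close>

definition proper_states :: "nat \<Rightarrow> nat list set" where
  "proper_states n = cube_states n - {replicate n 0, replicate n 1}"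

lemma proper_states_iff:
  "\<epsilon> \<in> proper_states n \<longleftrightarrow> \<epsilon> \<in> cube_states n \<and> ones \<epsilon> \<noteq> {} \<and> ones \<epsilon> \<noteq> {..<n}"
  unfolding proper_states_def
  using ones_eq_iff[of \<epsilon> n "replicate n 0"] ones_eq_iff[of \<epsilon> n "replicate n 1"]
    replicate_in_cube_states[of n] ones_replicate[of n] by auto

definition intermediate ::
    "'a list \<Rightarrow> ('s, 'l, 'a) ts \<Rightarrow> ('a \<times> nat \<Rightarrow> 'l) \<Rightarrow> 's \<Rightarrow> 's \<Rightarrow> nat list \<Rightarrow> 's \<Rightarrow> bool" where
  "intermediate as C f \<alpha> \<beta> \<epsilon> \<nu> \<longleftrightarrow>
     mtrans C \<alpha> (edge_actions as f (ones \<epsilon>)) \<nu> \<and>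
     mtrans C \<nu> (edge_actions as f ({..<length as} - ones \<epsilon>)) \<beta>"

text \<open>
  The key lemma: a map on vertices that preserves the transitions through the two extreme
  vertices preserves all of them. For \<open>ones \<epsilon> \<subset> ones \<epsilon>'\<close> the directions split into those before \<open>\<epsilon>\<close>,
  those between \<open>\<epsilon>\<close> and \<open>\<epsilon>'\<close>, and those after \<open>\<epsilon>'\<close>; coherence with these three blocks yields the
  transition between the images of \<open>\<epsilon>\<close> and \<open>\<epsilon>'\<close>. The conditions at different vertices are
  independent of each other, which both directions of the orthogonality criterion exploit.
\<close>

lemma hom_cube_iff_intermediate:
  assumes "whdts \<Sigma> C" "as \<noteq> []"
  shows "(g0, g1) \<in> hom (cube as) C \<longleftrightarrow>
     g0 \<in> states (cube as) \<rightarrow>\<^sub>E states C \<and> action_map as C g1 \<and>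
     mtrans C (g0 (replicate (length as) 0)) (edge_actions as g1 {..<length as})
       (g0 (replicate (length as) 1)) \<and>
     (\<forall>\<epsilon> \<in> proper_states (length as). intermediate as C g1
        (g0 (replicate (length as) 0)) (g0 (replicate (length as) 1)) \<epsilon> (g0 \<epsilon>))"
proof -
  let ?n = "length as" and ?S = "cube_states (length as)" and ?E = "edge_actions as g1"
  let ?z = "replicate ?n (0::nat)" and ?o = "replicate ?n (1::nat)"
  have ax: "multiset_axiom C" "coherence_axiom C"
    using assms(1) unfolding whdts_def by auto
  note z = replicate_in_cube_states(1)[of ?n] ones_replicate(1)[of ?n]
  note o = replicate_in_cube_states(2)[of ?n] ones_replicate(2)[of ?n]
  have ne: "{..<?n} \<noteq> {}"
    using assms(2) by auto
  have "(\<forall>\<epsilon> \<in> ?S. \<forall>\<epsilon>' \<in> ?S. ones \<epsilon> \<subset> ones \<epsilon>' \<longrightarrow>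
        mtrans C (g0 \<epsilon>) (?E (ones \<epsilon>' - ones \<epsilon>)) (g0 \<epsilon>')) \<longleftrightarrow>
      mtrans C (g0 ?z) (?E {..<?n}) (g0 ?o) \<and>
      (\<forall>\<epsilon> \<in> proper_states ?n. intermediate as C g1 (g0 ?z) (g0 ?o) \<epsilon> (g0 \<epsilon>))"
    (is "?L \<longleftrightarrow> ?T \<and> ?I")
  proof
    assume L: ?L
    have "mtrans C (g0 ?z) (?E (ones ?o - ones ?z)) (g0 ?o)"
      by (rule L[rule_format, OF z(1) o(1)]) (use ne z(2) o(2) in auto)
    moreover have "intermediate as C g1 (g0 ?z) (g0 ?o) \<epsilon> (g0 \<epsilon>)" if "\<epsilon> \<in> proper_states ?n" for \<epsilon>
    proof -
      have e: "\<epsilon> \<in> ?S" "ones ?z \<subset> ones \<epsilon>" "ones \<epsilon> \<subset> ones ?o"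
        using that ones_subset[of \<epsilon> ?n] unfolding proper_states_iff z o by auto
      have "mtrans C (g0 ?z) (?E (ones \<epsilon> - ones ?z)) (g0 \<epsilon>)"
        "mtrans C (g0 \<epsilon>) (?E (ones ?o - ones \<epsilon>)) (g0 ?o)"
        using L[rule_format, OF z(1) e(1) e(2)] L[rule_format, OF e(1) o(1) e(3)] .
      then show ?thesis
        unfolding intermediate_def z o by simp
    qed
    ultimately show "?T \<and> ?I"
      unfolding z o by simp
  next
    assume TI: "?T \<and> ?I"
    show ?L
    proof (intro ballI impI)
      fix \<epsilon> \<epsilon>'
      assume e: "\<epsilon> \<in> ?S" "\<epsilon>' \<in> ?S" "ones \<epsilon> \<subset> ones \<epsilon>'"
      note sub = ones_subset[OF e(1)] ones_subset[OF e(2)]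
      have I: "intermediate as C g1 (g0 ?z) (g0 ?o) \<delta> (g0 \<delta>)"
        if "\<delta> \<in> ?S" "ones \<delta> \<noteq> {}" "ones \<delta> \<noteq> {..<?n}" for \<delta>
        using TI that proper_states_iff[of \<delta> ?n] by simp
      have zI: "\<epsilon> = ?z \<longleftrightarrow> ones \<epsilon> = {}"
        using ones_eq_iff[OF e(1) z(1)] z(2) by simp
      have oI: "\<epsilon>' = ?o \<longleftrightarrow> ones \<epsilon>' = {..<?n}"
        using ones_eq_iff[OF e(2) o(1)] o(2) by simp
      consider "\<epsilon> = ?z" "\<epsilon>' = ?o" | "\<epsilon> = ?z" "ones \<epsilon>' \<noteq> {..<?n}" | "ones \<epsilon> \<noteq> {}" "\<epsilon>' = ?o"
        | "ones \<epsilon> \<noteq> {}" "ones \<epsilon>' \<noteq> {..<?n}"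
        using zI oI by blast
      then show "mtrans C (g0 \<epsilon>) (?E (ones \<epsilon>' - ones \<epsilon>)) (g0 \<epsilon>')"
      proof cases
        case 1
        then show ?thesis using TI z(2) o(2) by simp
      next
        case 2
        moreover have "ones \<epsilon>' \<noteq> {}" using e(3) by auto
        ultimately show ?thesis using I[OF e(2)] z(2) unfolding intermediate_def by simp
      next
        case 3
        moreover have "ones \<epsilon> \<noteq> {..<?n}" using e(3) sub by auto
        ultimately show ?thesis using I[OF e(1)] o(2) unfolding intermediate_def by simp
      next
        case 4
        let ?A = "ones \<epsilon>" and ?B = "ones \<epsilon>' - ones \<epsilon>" and ?D = "{..<?n} - ones \<epsilon>'"
        have fin: "finite ?A" "finite ?B" "finite ?D"
          using sub[THEN finite_subset] by auto
        have "?A \<noteq> {}" "?B \<noteq> {}" "?D \<noteq> {}"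
          using 4 e sub by auto
        then have nonempty: "?E ?A \<noteq> {#}" "?E ?B \<noteq> {#}" "?E ?D \<noteq> {#}"
          using edge_actions_eq_empty_iff fin by metis+
        have dis: "?A \<inter> ?B = {}" "?B \<inter> ?D = {}" "(?A \<union> ?B) \<inter> ?D = {}"
          using e(3) by auto
        have "{..<?n} = (?A \<union> ?B) \<union> ?D" "ones \<epsilon>' = ?A \<union> ?B" "{..<?n} - ?A = ?B \<union> ?D"
          using sub e by auto
        moreover have "?E ((?A \<union> ?B) \<union> ?D) = ?E ?A + ?E ?B + ?E ?D"
          "?E (?A \<union> ?B) = ?E ?A + ?E ?B" "?E (?B \<union> ?D) = ?E ?B + ?E ?D"
          using edge_actions_Un[of "?A \<union> ?B" ?D as g1] edge_actions_Un[of ?A ?B as g1]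
            edge_actions_Un[of ?B ?D as g1] fin dis by simp_all
        ultimately have sums: "?E {..<?n} = ?E ?A + ?E ?B + ?E ?D"
          "?E (ones \<epsilon>') = ?E ?A + ?E ?B" "?E ({..<?n} - ?A) = ?E ?B + ?E ?D"
          by metis+
        have "ones \<epsilon> \<noteq> {..<?n}" "ones \<epsilon>' \<noteq> {}"
          using e(3) sub by auto
        then have i: "intermediate as C g1 (g0 ?z) (g0 ?o) \<epsilon> (g0 \<epsilon>)"
          "intermediate as C g1 (g0 ?z) (g0 ?o) \<epsilon>' (g0 \<epsilon>')"
          using I[OF e(1)] I[OF e(2)] 4 by simp_all
        show ?thesis
          by (rule mtrans_coherence[OF ax nonempty, of "g0 ?z" "g0 ?o"])
            (use TI i sums in \<open>auto simp: intermediate_def\<close>)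
      qed
    qed
  qed
  then show ?thesis
    unfolding hom_cube_iff[OF ax(1)] by blast
qed

section \<open>Orthogonality to the inclusions of the extended cubes\<close>

lemma comp_from_inclusion:
  "comp_from X g (inclusion X) = (restrict (fst g) (states X), restrict (snd g) (actions X))"
  unfolding comp_from_def inclusion_def compose_def by (auto simp: restrict_def)

lemma restrict_eq_iff: "f \<in> extensional A \<Longrightarrow> restrict g A = f \<longleftrightarrow> (\<forall>x \<in> A. g x = f x)"
  by (auto simp: fun_eq_iff extensional_def)

text \<open>
  The extended cube has all actions of the cube, so only the images of vertices are left
  to choose in an extension.
\<close>

lemma factorization_iff:
  assumes "g \<in> hom (cube as) C" "f \<in> hom (cube_ext as) C"
  shows "comp_from (cube_ext as) g (inclusion (cube_ext as)) = f \<longleftrightarrow>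
     fst g (replicate (length as) 0) = fst f (replicate (length as) 0) \<and>
     fst g (replicate (length as) 1) = fst f (replicate (length as) 1) \<and> snd g = snd f"
proof -
  have acts: "actions (cube_ext as) = actions (cube as)"
    unfolding cube_ext_def cube_def by simp
  have "restrict (snd g) (actions (cube_ext as)) = snd g"
    using assms(1) unfolding hom_def acts by (auto simp: extensional_restrict PiE_def)
  moreover have "restrict (fst g) (states (cube_ext as)) = fst f \<longleftrightarrow>
      fst g (replicate (length as) 0) = fst f (replicate (length as) 0) \<and>
      fst g (replicate (length as) 1) = fst f (replicate (length as) 1)"
  proof -
    have "fst f \<in> extensional (states (cube_ext as))"
      using assms(2) unfolding hom_def by (auto simp: PiE_def)
    note restrict_eq_iff[OF this, of "fst g"]
    then show ?thesis
      by (simp add: cube_ext_def)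
  qed
  ultimately show ?thesis
    unfolding comp_from_inclusion by (auto simp: prod_eq_iff)
qed

text \<open>
  The extension sends each further vertex to the unique intermediate state with the
  corresponding actions; there is no other choice.
\<close>

lemma orthogonal_if_unique_intermediate:
  assumes C: "whdts \<Sigma> C" and uni: "unique_intermediate C" and as: "2 \<le> length as"
  shows "orthogonal C (cube_ext as, inclusion (cube_ext as), cube as)"
  unfolding orthogonal_def prod.case
proof
  fix f assume f: "f \<in> hom (cube_ext as) C"
  obtain f0 f1 where f_eq: "f = (f0, f1)" by (cases f)
  let ?n = "length as" and ?S = "cube_states (length as)" and ?E = "edge_actions as f1"
  let ?z = "replicate ?n (0::nat)" and ?o = "replicate ?n (1::nat)"
  have ax: "multiset_axiom C" "ts_carrier \<Sigma> C"
    using C unfolding whdts_def by auto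
  have as_ne: "as \<noteq> []" using as by auto
  note f' = f[unfolded f_eq hom_cube_ext_iff[OF ax(1)]]
  define mid where "mid \<epsilon> = (THE \<nu>. intermediate as C f1 (f0 ?z) (f0 ?o) \<epsilon> \<nu>)" for \<epsilon>
  have ex1: "\<exists>!\<nu>. intermediate as C f1 (f0 ?z) (f0 ?o) \<epsilon> \<nu>" if "\<epsilon> \<in> proper_states ?n" for \<epsilon>
  proof -
    have e: "ones \<epsilon> \<subseteq> {..<?n}" "ones \<epsilon> \<noteq> {}" "{..<?n} - ones \<epsilon> \<noteq> {}"
      using that ones_subset[of \<epsilon> ?n] unfolding proper_states_iff by auto
    have fin: "finite (ones \<epsilon>)"
      using e(1) finite_subset by auto
    have "?E {..<?n} = ?E (ones \<epsilon>) + ?E ({..<?n} - ones \<epsilon>)"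
      by (rule edge_actions_split[OF e(1)])
    then show ?thesis
      unfolding intermediate_def using f' e fin
      by (intro unique_intermediateD[OF uni]) (auto simp: edge_actions_eq_empty_iff)
  qed
  have mid: "intermediate as C f1 (f0 ?z) (f0 ?o) \<epsilon> (mid \<epsilon>)" if "\<epsilon> \<in> proper_states ?n" for \<epsilon>
    unfolding mid_def by (rule theI'[OF ex1[OF that]])
  define g0 where "g0 = (\<lambda>\<epsilon> \<in> ?S. if \<epsilon> = ?z \<or> \<epsilon> = ?o then f0 \<epsilon> else mid \<epsilon>)"
  have ends: "g0 ?z = f0 ?z" "g0 ?o = f0 ?o"
    unfolding g0_def using replicate_in_cube_states[of ?n] by auto
  have proper: "g0 \<epsilon> = mid \<epsilon>" if "\<epsilon> \<in> proper_states ?n" for \<epsilon>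
    using that unfolding g0_def proper_states_def by auto
  have "g0 \<epsilon> \<in> states C" if "\<epsilon> \<in> ?S" for \<epsilon>
  proof (cases "\<epsilon> \<in> proper_states ?n")
    case True
    then show ?thesis
      using mid[OF True] mtrans_states(2)[OF ax(2)] proper[OF True]
      unfolding intermediate_def by metis
  next
    case False
    then have "\<epsilon> = ?z \<or> \<epsilon> = ?o"
      using that unfolding proper_states_def by auto
    then show ?thesis
      using ends mtrans_states[OF ax(2), of "f0 ?z" _ "f0 ?o"] f' by auto
  qed
  then have "g0 \<in> states (cube as) \<rightarrow>\<^sub>E states C"
    unfolding g0_def by (auto simp: cube_def)
  then have g: "(g0, f1) \<in> hom (cube as) C"
    unfolding hom_cube_iff_intermediate[OF C as_ne] ends using f' mid proper by simp
  show "\<exists>!g. g \<in> hom (cube as) C \<and> comp_from (cube_ext as) g (inclusion (cube_ext as)) = f"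
  proof (intro ex1I conjI)
    show "(g0, f1) \<in> hom (cube as) C" by fact
    show "comp_from (cube_ext as) (g0, f1) (inclusion (cube_ext as)) = f"
      unfolding factorization_iff[OF g f] using ends f_eq by simp
  next
    fix h
    assume h: "h \<in> hom (cube as) C \<and> comp_from (cube_ext as) h (inclusion (cube_ext as)) = f"
    obtain h0 h1 where h_eq: "h = (h0, h1)" by (cases h)
    have fac: "h0 ?z = f0 ?z" "h0 ?o = f0 ?o" "h1 = f1"
      using h factorization_iff[OF conjunct1[OF h] f] unfolding h_eq f_eq by auto
    have hh: "h0 \<in> ?S \<rightarrow>\<^sub>E states C"
      "\<forall>\<epsilon> \<in> proper_states ?n. intermediate as C f1 (f0 ?z) (f0 ?o) \<epsilon> (h0 \<epsilon>)"
      using conjunct1[OF h] unfolding h_eq hom_cube_iff_intermediate[OF C as_ne] fac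
      by (auto simp: cube_def)
    have "h0 \<epsilon> = g0 \<epsilon>" for \<epsilon>
    proof -
      consider "\<epsilon> \<notin> ?S" | "\<epsilon> = ?z" | "\<epsilon> = ?o" | "\<epsilon> \<in> proper_states ?n"
        unfolding proper_states_def by auto
      then show ?thesis
      proof cases
        case 1
        then show ?thesis using hh(1) unfolding g0_def by auto
      next
        case 4
        then show ?thesis
          using ex1[OF 4] hh(2)[rule_format, OF 4] mid[OF 4] proper[OF 4] by auto
      qed (use ends fac in auto)
    qed
    then have "h0 = g0" by (rule ext)
    then show "h = (g0, f1)"
      using h_eq fac(3) by simp
  qed
qed

text \<open>
  Existence: list \<open>A\<close> before \<open>B\<close>, extend the transition to the cube on the labels, and take the image of
  the vertex \<open>\<epsilon>\<close> whose ones are the positions of \<open>A\<close>. Uniqueness: if \<open>\<nu>\<close> is any intermediate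
  state, then redefining the extension at the single vertex \<open>\<epsilon>\<close> to be \<open>\<nu>\<close> gives another extension,
  and this one has to be the same.
\<close>

lemma unique_intermediate_if_orthogonal:
  assumes C: "whdts \<Sigma> C"
    and orth: "\<And>as. 2 \<le> length as \<Longrightarrow> set as \<subseteq> \<Sigma> \<Longrightarrow>
      orthogonal C (cube_ext as, inclusion (cube_ext as), cube as)"
  shows "unique_intermediate C"
  unfolding unique_intermediate_def
proof (intro allI impI, elim conjE)
  fix \<alpha> A B \<beta>
  assume ne: "A \<noteq> {#}" "B \<noteq> {#}" and tr: "mtrans C \<alpha> (A + B) \<beta>"
  have ax: "multiset_axiom C" "ts_carrier \<Sigma> C"
    using C unfolding whdts_def by auto
  obtain xs ys where ms: "A = mset xs" "B = mset ys"
    by (metis ex_mset)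
  define us where "us = xs @ ys"
  define as where "as = map (label C) us"
  \<comment> \<open>The action at position \<open>i\<close> has second component \<open>Suc i\<close>.\<close>
  define f1 where "f1 = (\<lambda>u \<in> actions (cube as). us ! (snd u - 1))"
  let ?n = "length as" and ?S = "cube_states (length as)" and ?E = "edge_actions as f1"
  let ?z = "replicate ?n (0::nat)" and ?o = "replicate ?n (1::nat)"
  define f0 where "f0 = (\<lambda>\<epsilon> \<in> {?z, ?o}. if \<epsilon> = ?z then \<alpha> else \<beta>)"
  have len: "xs \<noteq> []" "ys \<noteq> []" "2 \<le> ?n" "?n = length xs + length ys"
    using ne ms unfolding as_def us_def by (cases xs; cases ys; auto)+
  have as_ne: "as \<noteq> []" using len(3) by auto
  have zo: "?z \<noteq> ?o" using as_ne by (auto simp: replicate_eq_replicate)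
  have us: "(\<alpha>, us, \<beta>) \<in> transitions C"
    using tr unfolding ms us_def mtrans_mset_iff[OF ax(1), symmetric] by simp
  have acts: "set us \<subseteq> actions C" "label C \<in> actions C \<rightarrow> \<Sigma>"
    using us ax(2) unfolding ts_carrier_def by blast+
  have f1: "f1 (cube_action as i) = us ! i" if "i < ?n" for i
    using that unfolding f1_def by (auto simp: cube_def cube_action_def)
  have E: "?E K = image_mset ((!) us) (mset_set K)" if "K \<subseteq> {..<?n}" for K
    unfolding edge_actions_def using that f1 finite_subset[OF that]
    by (intro image_mset_cong) (auto simp: subset_iff)
  have us_n: "length us = ?n" unfolding as_def by simp
  have E_xs: "?E {..<length xs} = A"
  proof -
    have "?E {..<length xs} = image_mset ((!) us) (mset [0..<length xs])"
      using len(4) by (subst E) (auto simp: lessThan_atLeast0)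
    also have "\<dots> = mset (map ((!) us) [0..<length xs])"
      by simp
    also have "map ((!) us) [0..<length xs] = xs"
      by (rule nth_equalityI) (auto simp: us_def nth_append)
    finally show ?thesis using ms by simp
  qed
  have E_all: "?E {..<?n} = A + B"
  proof -
    have "?E {..<?n} = image_mset ((!) us) (mset [0..<?n])"
      by (subst E) (auto simp: lessThan_atLeast0)
    also have "\<dots> = mset (map ((!) us) [0..<length us])"
      by (simp add: us_n)
    also have "\<dots> = A + B"
      unfolding map_nth by (simp add: us_def ms)
    finally show ?thesis .
  qed
  have sub: "{..<length xs} \<subseteq> {..<?n}" using len(4) by auto
  have E_ys: "?E ({..<?n} - {..<length xs}) = B"
    using edge_actions_split[OF sub, of as f1] E_all E_xs by simp
  have "action_map as C f1"
    unfolding action_map_def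
  proof (intro conjI ballI)
    show "f1 \<in> actions (cube as) \<rightarrow>\<^sub>E actions C"
    proof (rule PiE_I)
      fix u assume "u \<in> actions (cube as)"
      then obtain i where i: "i < ?n" "u = cube_action as i"
        unfolding cube_def by auto
      then have "us ! i \<in> set us"
        using us_n by simp
      then show "f1 u \<in> actions C"
        using acts(1) unfolding i(2) f1[OF i(1)] by blast
    qed (simp add: f1_def)
    fix u assume "u \<in> actions (cube as)"
    then obtain i where i: "i < ?n" "u = cube_action as i"
      unfolding cube_def by auto
    have "label C (us ! i) = as ! i"
      using i(1) unfolding as_def by simp
    then show "label C (f1 u) = fst u"
      unfolding i(2) f1[OF i(1)] by (simp add: cube_action_def)
  qed
  moreover have "f0 \<in> states (cube_ext as) \<rightarrow>\<^sub>E states C"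
    using mtrans_states[OF ax(2) tr] by (auto simp: f0_def cube_ext_def)
  moreover have f0: "f0 ?z = \<alpha>" "f0 ?o = \<beta>"
    using zo unfolding f0_def by auto
  ultimately have f: "(f0, f1) \<in> hom (cube_ext as) C"
    unfolding hom_cube_ext_iff[OF ax(1)] using tr E_all by simp
  have "set as \<subseteq> \<Sigma>"
    using acts unfolding as_def by auto
  from orth[OF len(3) this] f
  have ex1: "\<exists>!g. g \<in> hom (cube as) C \<and>
      comp_from (cube_ext as) g (inclusion (cube_ext as)) = (f0, f1)"
    unfolding orthogonal_def by auto
  then obtain g where g: "g \<in> hom (cube as) C"
      "comp_from (cube_ext as) g (inclusion (cube_ext as)) = (f0, f1)"
    by blast
  obtain g0 where g_eq: "g = (g0, f1)" and ends: "g0 ?z = \<alpha>" "g0 ?o = \<beta>"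
    using factorization_iff[OF g(1) f] g(2) f0 by (cases g) auto
  note g' = g(1)[unfolded g_eq hom_cube_iff_intermediate[OF C as_ne] ends]
  obtain \<epsilon> where e: "\<epsilon> \<in> ?S" "ones \<epsilon> = {..<length xs}"
    using ex_cube_state[OF sub] by blast
  have ep: "\<epsilon> \<in> proper_states ?n"
    using e len unfolding proper_states_iff by auto
  have int_iff: "intermediate as C f1 \<alpha> \<beta> \<epsilon> \<nu> \<longleftrightarrow> mtrans C \<alpha> A \<nu> \<and> mtrans C \<nu> B \<beta>" for \<nu>
    unfolding intermediate_def e(2) E_xs E_ys ..
  show "\<exists>!\<nu>. mtrans C \<alpha> A \<nu> \<and> mtrans C \<nu> B \<beta>"
    unfolding int_iff[symmetric]
  proof (intro ex1I)
    show "intermediate as C f1 \<alpha> \<beta> \<epsilon> (g0 \<epsilon>)"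
      using g' ep by blast
  next
    fix \<nu> assume \<nu>: "intermediate as C f1 \<alpha> \<beta> \<epsilon> \<nu>"
    let ?h = "g0(\<epsilon> := \<nu>)"
    have h_ends: "?h ?z = \<alpha>" "?h ?o = \<beta>"
      using ep ends unfolding proper_states_def by auto
    have "\<nu> \<in> states C"
      using \<nu> mtrans_states(2)[OF ax(2)] unfolding intermediate_def by blast
    then have "?h \<in> states (cube as) \<rightarrow>\<^sub>E states C"
      using g' e(1) by (auto simp: cube_def PiE_def extensional_def Pi_def)
    then have h: "(?h, f1) \<in> hom (cube as) C"
      unfolding hom_cube_iff_intermediate[OF C as_ne] h_ends using g' \<nu> by simp
    have "comp_from (cube_ext as) (?h, f1) (inclusion (cube_ext as)) = (f0, f1)"
      unfolding factorization_iff[OF h f] using h_ends f0 by simp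
    then have "(?h, f1) = (g0, f1)"
      using ex1 g h unfolding g_eq by blast
    then show "\<nu> = g0 \<epsilon>"
      by (metis fun_upd_same prod.inject)
  qed
qed

section \<open>Orthogonality to the collapse of a doubled edge\<close>

lemma cube_singleton:
  "states (cube [a]) = {[0], [1]}" "actions (cube [a]) = {(a, 1)}" "label (cube [a]) = fst"
  "transitions (cube [a]) = {([0], [(a, 1)], [1])}"
proof -
  have S: "cube_states (Suc 0) = {[0], [1]}"
    unfolding cube_states_def by (auto simp: length_Suc_conv)
  show "states (cube [a]) = {[0], [1]}" "actions (cube [a]) = {(a, 1)}" "label (cube [a]) = fst"
    using S by (auto simp: cube_def cube_action_def)
  have o: "ones [0] = {}" "ones [1] = {0}"
    unfolding ones_def by auto
  have d: "distinct is \<and> set is = {0} \<longleftrightarrow> is = [0]" for "is" :: "nat list"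
    by (cases "is" rule: remdups_adj.cases) auto
  have "(\<epsilon>, us, \<epsilon>') \<in> transitions (cube [a]) \<longleftrightarrow> \<epsilon> = [0] \<and> us = [(a, 1)] \<and> \<epsilon>' = [1]" for \<epsilon> us \<epsilon>'
  proof
    assume "(\<epsilon>, us, \<epsilon>') \<in> transitions (cube [a])"
    then obtain "is" where *: "\<epsilon> \<in> {[0], [1]}" "\<epsilon>' \<in> {[0], [1]}" "ones \<epsilon> \<subset> ones \<epsilon>'"
      and idx: "us = map (cube_action [a]) is" "distinct is" "set is = ones \<epsilon>' - ones \<epsilon>"
      unfolding cube_transitions_iff using S by auto
    from * have ends: "\<epsilon> = [0]" "\<epsilon>' = [1]"
      using o by auto
    then have "is = [0]"
      using idx(2,3) o by (intro iffD1[OF d]) simp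
    then show "\<epsilon> = [0] \<and> us = [(a, 1)] \<and> \<epsilon>' = [1]"
      using idx(1) ends by (simp add: cube_action_def)
  next
    assume *: "\<epsilon> = [0] \<and> us = [(a, 1)] \<and> \<epsilon>' = [1]"
    then have "us = map (cube_action [a]) [0]"
      by (simp add: cube_action_def)
    then show "(\<epsilon>, us, \<epsilon>') \<in> transitions (cube [a])"
      using * S o by (simp only: cube_transitions_map_iff) auto
  qed
  then show "transitions (cube [a]) = {([0], [(a, 1)], [1])}"
    by auto
qed

definition collapse :: "'a \<Rightarrow> (nat list \<Rightarrow> nat list) \<times> ('a \<times> nat \<Rightarrow> 'a \<times> nat)" where
  "collapse a = (restrict id {[0], [1]}, \<lambda>u \<in> {(a, 1), (a, 2)}. (a, 1))"

lemma hom_double_iff: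
  "(f0, f1) \<in> hom (double a) C \<longleftrightarrow>
     f0 \<in> {[0], [1]} \<rightarrow>\<^sub>E states C \<and> f1 \<in> {(a, 1), (a, 2)} \<rightarrow>\<^sub>E actions C \<and>
     label C (f1 (a, 1)) = a \<and> label C (f1 (a, 2)) = a \<and>
     (f0 [0], [f1 (a, 1)], f0 [1]) \<in> transitions C \<and>
     (f0 [0], [f1 (a, 2)], f0 [1]) \<in> transitions C"
  unfolding hom_def double_def by auto

lemma hom_cube_singleton_iff:
  "(f0, f1) \<in> hom (cube [a]) C \<longleftrightarrow>
     f0 \<in> {[0], [1]} \<rightarrow>\<^sub>E states C \<and> f1 \<in> {(a, 1)} \<rightarrow>\<^sub>E actions C \<and>
     label C (f1 (a, 1)) = a \<and> (f0 [0], [f1 (a, 1)], f0 [1]) \<in> transitions C"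
  unfolding hom_def cube_singleton by auto

text \<open>
  The one-dimensional cube has a single transition, to which both transitions of \<open>D[a]\<close> must go.
\<close>

lemma hom_double_cube: "hom (double a) (cube [a]) = {collapse a}"
proof -
  have "(f0, f1) \<in> hom (double a) (cube [a]) \<longleftrightarrow> (f0, f1) = collapse a" for f0 f1
  proof
    assume "(f0, f1) \<in> hom (double a) (cube [a])"
    then have *: "f0 [0] = [0]" "f0 [1] = [1]" "f1 (a, 1) = (a, 1)" "f1 (a, 2) = (a, 1)"
      "f0 \<in> extensional {[0], [1]}" "f1 \<in> extensional {(a, 1), (a, 2)}"
      unfolding hom_double_iff cube_singleton by (auto simp: PiE_def)
    have "f0 = restrict id {[0], [1]}"
      by (rule extensionalityI[OF *(5)]) (use * in auto)
    moreover have "f1 = (\<lambda>u \<in> {(a, 1), (a, 2)}. (a, 1))"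
      by (rule extensionalityI[OF *(6)]) (use * in auto)
    ultimately show "(f0, f1) = collapse a"
      unfolding collapse_def by simp
  next
    assume "(f0, f1) = collapse a"
    then show "(f0, f1) \<in> hom (double a) (cube [a])"
      unfolding collapse_def hom_double_iff cube_singleton by auto
  qed
  then show ?thesis by auto
qed

lemma comp_from_collapse_iff:
  assumes "(f0, f1) \<in> hom (double a) C" "(g0, g1) \<in> hom (cube [a]) C"
  shows "comp_from (double a) (g0, g1) (collapse a) = (f0, f1) \<longleftrightarrow>
     g0 = f0 \<and> f1 (a, 1) = g1 (a, 1) \<and> f1 (a, 2) = g1 (a, 1)"
proof -
  have exts: "f0 \<in> extensional {[0], [1]}" "f1 \<in> extensional {(a, 1), (a, 2)}"
    "g0 \<in> extensional {[0], [1]}"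
    using assms unfolding hom_double_iff hom_cube_singleton_iff by (auto simp: PiE_def)
  have "compose {[0], [1]} g0 (restrict id {[0], [1]}) = g0"
    by (rule extensionalityI[of _ "{[0], [1]}"]) (use exts in \<open>auto simp: compose_def\<close>)
  moreover have "compose {(a, 1), (a, 2)} g1 (\<lambda>u \<in> {(a, 1), (a, 2)}. (a, 1)) = f1 \<longleftrightarrow>
      f1 (a, 1) = g1 (a, 1) \<and> f1 (a, 2) = g1 (a, 1)"
  proof -
    have "compose {(a, 1), (a, 2 :: nat)} g1 (\<lambda>u \<in> {(a, 1), (a, 2 :: nat)}. (a, 1)) =
        (\<lambda>u \<in> {(a, 1), (a, 2)}. g1 (a, 1))"
      by (auto simp: compose_def)
    then show ?thesis
      using restrict_eq_iff[OF exts(2), of "\<lambda>_. g1 (a, 1)"] by (simp only:) auto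
  qed
  ultimately show ?thesis
    unfolding comp_from_def collapse_def by (simp add: double_def)
qed

lemma orthogonal_collapse_iff:
  assumes "ts_carrier \<Sigma> C"
  shows "orthogonal C (double a, collapse a, cube [a]) \<longleftrightarrow>
     (\<forall>\<alpha> u u' \<beta>. (\<alpha>, [u], \<beta>) \<in> transitions C \<and> (\<alpha>, [u'], \<beta>) \<in> transitions C \<and>
        label C u = a \<and> label C u' = a \<longrightarrow> u = u')" (is "?L \<longleftrightarrow> ?R")
proof
  assume L: ?L
  show ?R
  proof (intro allI impI, elim conjE)
    fix \<alpha> u u' \<beta>
    assume tr: "(\<alpha>, [u], \<beta>) \<in> transitions C" "(\<alpha>, [u'], \<beta>) \<in> transitions C"
      and lab: "label C u = a" "label C u' = a"
    define f0 where "f0 = (\<lambda>\<epsilon> \<in> {[0], [1]}. if \<epsilon> = [0::nat] then \<alpha> else \<beta>)"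
    define f1 where "f1 = (\<lambda>x \<in> {(a, 1), (a, 2)}. if x = (a, 1::nat) then u else u')"
    have v: "f1 (a, 1) = u" "f1 (a, 2) = u'" "f0 [0] = \<alpha>" "f0 [1] = \<beta>"
      unfolding f0_def f1_def by auto
    have mem: "\<alpha> \<in> states C" "\<beta> \<in> states C" "u \<in> actions C" "u' \<in> actions C"
      using tr assms unfolding ts_carrier_def by force+
    have f: "(f0, f1) \<in> hom (double a) C"
      unfolding hom_double_iff v using tr lab mem by (auto simp: f0_def f1_def)
    have "\<exists>!g. g \<in> hom (cube [a]) C \<and> comp_from (double a) g (collapse a) = (f0, f1)"
      using L f unfolding orthogonal_def prod.case by (rule bspec)
    then obtain g where g: "g \<in> hom (cube [a]) C" "comp_from (double a) g (collapse a) = (f0, f1)"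
      by blast
    obtain g0 g1 where g_eq: "g = (g0, g1)" by (cases g)
    have "f1 (a, 1) = g1 (a, 1) \<and> f1 (a, 2) = g1 (a, 1)"
      using comp_from_collapse_iff[OF f g(1)[unfolded g_eq]] g(2)[unfolded g_eq] by blast
    then show "u = u'"
      using v by simp
  qed
next
  assume R: ?R
  show ?L
    unfolding orthogonal_def prod.case
  proof
    fix f assume f: "f \<in> hom (double a) C"
    obtain f0 f1 where f_eq: "f = (f0, f1)" by (cases f)
    note f' = f[unfolded f_eq hom_double_iff]
    have eq: "f1 (a, 2) = f1 (a, 1)"
      using R f' by blast
    let ?g1 = "restrict f1 {(a, 1)}"
    have g: "(f0, ?g1) \<in> hom (cube [a]) C"
      unfolding hom_cube_singleton_iff using f' by auto
    show "\<exists>!g. g \<in> hom (cube [a]) C \<and> comp_from (double a) g (collapse a) = f"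
    proof (intro ex1I conjI)
      show "(f0, ?g1) \<in> hom (cube [a]) C" by fact
      show "comp_from (double a) (f0, ?g1) (collapse a) = f"
        using comp_from_collapse_iff[OF f[unfolded f_eq] g] f_eq eq by simp
    next
      fix h assume h: "h \<in> hom (cube [a]) C \<and> comp_from (double a) h (collapse a) = f"
      obtain h0 h1 where h_eq: "h = (h0, h1)" by (cases h)
      have h_hom: "(h0, h1) \<in> hom (cube [a]) C"
        using h unfolding h_eq by blast
      then have "h1 \<in> extensional {(a, 1)}"
        unfolding hom_cube_singleton_iff by (simp add: PiE_def)
      moreover have "h0 = f0 \<and> f1 (a, 1) = h1 (a, 1) \<and> f1 (a, 2) = h1 (a, 1)"
        using h comp_from_collapse_iff[OF f[unfolded f_eq] h_hom] unfolding h_eq f_eq by blast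
      ultimately have h': "h0 = f0" "h1 (a, 1) = f1 (a, 1)" "h1 \<in> extensional {(a, 1)}"
        by simp_all
      have "h1 = ?g1"
        by (rule extensionalityI[OF h'(3)]) (use h' in auto)
      then show "h = (f0, ?g1)"
        using h_eq h' by simp
    qed
  qed
qed

text \<open>
  CSA1 speaks about arbitrary common labels; these lie in \<open>\<Sigma>\<close> because all labels of actions do.
\<close>

lemma CSA1_iff_orthogonal:
  assumes "ts_carrier \<Sigma> C"
  shows "CSA1 C \<longleftrightarrow> (\<forall>a \<in> \<Sigma>. orthogonal C (double a, collapse a, cube [a]))"
proof -
  have "label C u \<in> \<Sigma>" if "(\<alpha>, [u], \<beta>) \<in> transitions C" for \<alpha> u \<beta>
    using assms that unfolding ts_carrier_def by force
  then show ?thesis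
    unfolding CSA1_def orthogonal_collapse_iff[OF assms] by metis
qed

section \<open>The characterization\<close>

lemma cube_morphisms_eq:
  "cube_morphisms \<Sigma> = {(double a, collapse a, cube [a]) | a. a \<in> \<Sigma>} \<union>
     {(cube_ext as, inclusion (cube_ext as), cube as) | as. 2 \<le> length as \<and> set as \<subseteq> \<Sigma>}"
  unfolding cube_morphisms_def hom_double_cube by auto

lemma cube_morphisms_subset: "cube_morphisms \<Sigma> \<subseteq> whdts_morphisms \<Sigma>"
proof
  fix m assume "m \<in> cube_morphisms \<Sigma>"
  then consider a where "m = (double a, collapse a, cube [a])" "a \<in> \<Sigma>"
    | as where "m = (cube_ext as, inclusion (cube_ext as), cube as)" "2 \<le> length as" "set as \<subseteq> \<Sigma>"
    unfolding cube_morphisms_eq by blast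
  then show "m \<in> whdts_morphisms \<Sigma>"
  proof cases
    case 1
    then show ?thesis
      unfolding whdts_morphisms_def using whdts_double whdts_cube[of "[a]" \<Sigma>] by (simp add: hom_double_cube)
  next
    case 2
    then have "as \<noteq> []" by auto
    then show ?thesis
      unfolding whdts_morphisms_def
      using 2 whdts_cube whdts_cube_ext inclusion_in_hom by auto
  qed
qed

lemma HDTS_eq_orthogonality_class:
  "(HDTS \<Sigma> :: ('s, 'l, 'a) ts set) = orthogonality_class \<Sigma> (cube_morphisms \<Sigma>)"
proof -
  have "hdts \<Sigma> C \<longleftrightarrow> whdts \<Sigma> C \<and> (\<forall>m \<in> cube_morphisms \<Sigma>. orthogonal C m)" for C :: "('s, 'l, 'a) ts"
  proof -
    have "CSA1 C \<and> unique_intermediate C \<longleftrightarrow> (\<forall>m \<in> cube_morphisms \<Sigma>. orthogonal C m)" if "whdts \<Sigma> C"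
    proof -
      have "CSA1 C \<longleftrightarrow> (\<forall>a \<in> \<Sigma>. orthogonal C (double a, collapse a, cube [a]))"
        using CSA1_iff_orthogonal that unfolding whdts_def by blast
      moreover have "unique_intermediate C \<longleftrightarrow> (\<forall>as. 2 \<le> length as \<and> set as \<subseteq> \<Sigma> \<longrightarrow>
          orthogonal C (cube_ext as, inclusion (cube_ext as), cube as))"
        using orthogonal_if_unique_intermediate[OF that] unique_intermediate_if_orthogonal[OF that]
        by blast
      ultimately show ?thesis
        unfolding cube_morphisms_eq by blast
    qed
    then show ?thesis
      unfolding hdts_iff by blast
  qed
  then show ?thesis
    unfolding HDTS_def orthogonality_class_def by blast
qed

theorem corollary5p7:
  fixes \<Sigma> :: "'a set"
  assumes "\<Sigma> \<noteq> {}"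
  shows "(\<exists>M :: (nat list, 'a \<times> nat, 'a) ts_mor set.
            M \<subseteq> whdts_morphisms \<Sigma> \<and>
            (HDTS \<Sigma> :: ('s, 'l, 'a) ts set) = orthogonality_class \<Sigma> M) \<and>
         (\<forall>a \<in> \<Sigma>. \<exists>!f. f \<in> hom (double a) (cube [a])) \<and>
         cube_morphisms \<Sigma> \<subseteq> whdts_morphisms \<Sigma> \<and>
         (HDTS \<Sigma> :: ('s, 'l, 'a) ts set) = orthogonality_class \<Sigma> (cube_morphisms \<Sigma>)"
proof (intro conjI)
  show "\<exists>M :: (nat list, 'a \<times> nat, 'a) ts_mor set. M \<subseteq> whdts_morphisms \<Sigma> \<and>
      (HDTS \<Sigma> :: ('s, 'l, 'a) ts set) = orthogonality_class \<Sigma> M"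
    using cube_morphisms_subset HDTS_eq_orthogonality_class by blast
  show "\<forall>a \<in> \<Sigma>. \<exists>!f. f \<in> hom (double a) (cube [a])"
    unfolding hom_double_cube by simp
  show "cube_morphisms \<Sigma> \<subseteq> whdts_morphisms \<Sigma>"
    by (rule cube_morphisms_subset)
  show "(HDTS \<Sigma> :: ('s, 'l, 'a) ts set) = orthogonality_class \<Sigma> (cube_morphisms \<Sigma>)"
    by (rule HDTS_eq_orthogonality_class)
qed

end
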